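(* Let $q$ be a prime power and $d$ an integer with $d>\frac{q^2+3}{2}$. Then the parabolic quadric $\mathsf{Q}(2d,q)$ has no ovoid.
   Context: $\mathsf{Q}(2d,q)$ denotes the finite classical polar space of totally singular subspaces of a non-degenerate quadratic form on $V(2d+1,q)$, viewed in $\mathrm{PG}(2d,q)$; it has rank $d$ and its generators are the totally singular subspaces of projective dimension $d-1$. An ovoid of a finite polar space is a set $\mathcal{O}$ of points such that every generator meets $\mathcal{O}$ in exactly one point. *)

theory Defs
  imports "HOL-Analysis.Analysis" "HOL-Number_Theory.Prime_Powers"
begin

text \<open>Vectors live in \<open>'a ^ 'n\<close> for a finite field \<open>'a\<close>; the notions of subspace and dimension over \<open>'a\<close>
  are those of the interpretation \<open>vec\<close> (scalar multiplication \<open>*s\<close>).\<close>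

definition polar_form :: "('a::field ^ 'n \<Rightarrow> 'a) \<Rightarrow> 'a ^ 'n \<Rightarrow> 'a ^ 'n \<Rightarrow> 'a" where
  "polar_form Q u v = Q (u + v) - Q u - Q v"

definition quadratic_form :: "('a::field ^ 'n \<Rightarrow> 'a) \<Rightarrow> bool" where
  "quadratic_form Q \<longleftrightarrow>
     (\<forall>c v. Q (c *s v) = c\<^sup>2 * Q v) \<and>
     (\<forall>u. Vector_Spaces.linear (*s) (*) (polar_form Q u)) \<and>
     (\<forall>v. Vector_Spaces.linear (*s) (*) (\<lambda>u. polar_form Q u v))"

text \<open>Non-degeneracy is required of \<open>Q\<close>, not of its polar form: in characteristic 2 and odd dimension
  the polar form is alternating and always has a nonzero radical. The condition is that no singular
  vector other than 0 lies in the radical; in odd characteristic it amounts to the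
  polar form being non-degenerate.\<close>

definition nondegenerate :: "('a::field ^ 'n \<Rightarrow> 'a) \<Rightarrow> bool" where
  "nondegenerate Q \<longleftrightarrow> (\<forall>v. Q v = 0 \<and> (\<forall>w. polar_form Q v w = 0) \<longrightarrow> v = 0)"

definition totally_singular :: "('a::field ^ 'n \<Rightarrow> 'a) \<Rightarrow> ('a ^ 'n) set \<Rightarrow> bool" where
  "totally_singular Q W \<longleftrightarrow> vec.subspace W \<and> (\<forall>w\<in>W. Q w = 0)"

text \<open>\<open>vec.dim\<close> is the vector space dimension, one more than the projective dimension. Points and
  generators are both represented by the corresponding vector subspaces.\<close>

definition singular_points :: "('a::field ^ 'n \<Rightarrow> 'a) \<Rightarrow> ('a ^ 'n) set set" where
  "singular_points Q = {P. totally_singular Q P \<and> vec.dim P = 1}"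

text \<open>The argument \<open>d\<close> is the rank of the polar space.\<close>

definition generators :: "nat \<Rightarrow> ('a::field ^ 'n \<Rightarrow> 'a) \<Rightarrow> ('a ^ 'n) set set" where
  "generators d Q = {W. totally_singular Q W \<and> vec.dim W = d}"

definition ovoid :: "nat \<Rightarrow> ('a::field ^ 'n \<Rightarrow> 'a) \<Rightarrow> ('a ^ 'n) set set \<Rightarrow> bool" where
  "ovoid d Q \<O> \<longleftrightarrow>
     \<O> \<subseteq> singular_points Q \<and> (\<forall>W\<in>generators d Q. \<exists>!P. P \<in> \<O> \<and> P \<subseteq> W)"

end

(* Fix a generator W, a vector p spanning its ovoid point, and let X consist of the vectors x on
   ovoid points with B(p, x) = 1. Every coset v + W with B(p, v) = 1 meets X, and there are q^d such
   cosets, so |X| >= q^d. On the other hand two perpendicular ovoid points would span a totally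
   singular line, which extends to a generator with two ovoid points; hence B(x, y) is zero on X
   exactly when x = y. So the functions 1 - B(x, .)^(q-1) restricted to X are the indicators of its
   elements, while they lie in the space of forms of degree q - 1 in 2d + 1 coordinates (on X the
   constant 1 is B(p, .)^(q-1)). This gives q^d <= (2d + 1)^(q-1), which fails for 2d > q^2 + 3. *)

theory Submission
  imports Defs "HOL-Number_Theory.Residues"
begin

section \<open>Linear independence and forms of degree q - 1\<close>

text \<open>Duality makes the coefficient rows \<open>a x\<close> linearly independent in a space of
  dimension \<open>card T\<close>. Independence is used through counting: \<open>g\<close> can be
  read back from its image under \<open>?\<Phi>\<close>, so there are at least as many functions on
  \<open>T\<close> as on \<open>X\<close>.\<close>

lemma card_le_of_dual_systems:
  fixes a :: "'x \<Rightarrow> 't \<Rightarrow> 'a::{field,finite}" and m :: "'t \<Rightarrow> 'x \<Rightarrow> 'a"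
  assumes X: "finite X" and T: "finite T"
    and dual: "\<And>x y. x \<in> X \<Longrightarrow> y \<in> X \<Longrightarrow> (\<Sum>t\<in>T. a x t * m t y) = (if x = y then 1 else 0)"
  shows "card X \<le> card T"
proof -
  let ?\<Phi> = "\<lambda>g. restrict (\<lambda>t. \<Sum>x\<in>X. g x * a x t) T"
  have rec: "(\<Sum>t\<in>T. ?\<Phi> g t * m t y) = g y" if y: "y \<in> X" for g y
  proof -
    have "(\<Sum>t\<in>T. ?\<Phi> g t * m t y) = (\<Sum>t\<in>T. \<Sum>x\<in>X. g x * (a x t * m t y))"
      by (simp add: sum_distrib_right mult.assoc)
    also have "\<dots> = (\<Sum>x\<in>X. g x * (\<Sum>t\<in>T. a x t * m t y))"
      by (subst sum.swap) (simp add: sum_distrib_left)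
    also have "\<dots> = (\<Sum>x\<in>X. if x = y then g x else 0)"
      by (intro sum.cong) (auto simp: dual y)
    also have "\<dots> = g y" using X y by simp
    finally show ?thesis .
  qed
  have "inj_on ?\<Phi> (X \<rightarrow>\<^sub>E UNIV)"
  proof (rule inj_onI)
    fix g h assume gh: "g \<in> X \<rightarrow>\<^sub>E UNIV" "h \<in> X \<rightarrow>\<^sub>E UNIV" "?\<Phi> g = ?\<Phi> h"
    show "g = h"
    proof (rule PiE_ext[OF gh(1,2)])
      fix y assume "y \<in> X"
      then show "g y = h y" using rec[of y g] rec[of y h] by (simp only: gh(3))
    qed
  qed
  moreover have "?\<Phi> ` (X \<rightarrow>\<^sub>E UNIV) \<subseteq> T \<rightarrow>\<^sub>E UNIV" by auto
  ultimately have "card (X \<rightarrow>\<^sub>E (UNIV::'a set)) \<le> card (T \<rightarrow>\<^sub>E (UNIV::'a set))"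
    by (intro card_inj_on_le) (auto intro!: finite_PiE T)
  then have "CARD('a) ^ card X \<le> CARD('a) ^ card T" by (simp add: card_PiE X T)
  moreover have "1 < CARD('a)"
    using card_mono[of UNIV "{0,1::'a}"] by simp
  ultimately show ?thesis by (rule power_le_imp_le_exp[rotated])
qed

text \<open>Monomials are indexed by words \<open>t\<close> of length \<open>k\<close>, so that no
  multinomial coefficients occur and their number is a plain power.\<close>

lemma sum_power_eq_sum_monomials:
  fixes a :: "'n::finite \<Rightarrow> 'a::comm_semiring_1"
  shows "(\<Sum>i\<in>UNIV. a i * y i) ^ k =
    (\<Sum>t\<in>{..<k} \<rightarrow>\<^sub>E UNIV. (\<Prod>j<k. a (t j)) * (\<Prod>j<k. y (t j)))"
proof -
  have "(\<Sum>i\<in>UNIV. a i * y i) ^ k = (\<Prod>j<k. \<Sum>i\<in>UNIV. a i * y i)" by simp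
  also have "\<dots> = (\<Sum>t\<in>{..<k} \<rightarrow>\<^sub>E UNIV. \<Prod>j<k. a (t j) * y (t j))"
    by (subst prod_sum_PiE) auto
  finally show ?thesis by (simp add: prod.distrib)
qed

text \<open>Multiplication by \<open>x\<close> permutes the nonzero elements and so preserves their
  product.\<close>

lemma finite_field_power_pred_card:
  fixes x :: "'a::{field,finite}"
  assumes "x \<noteq> 0"
  shows "x ^ (CARD('a) - 1) = 1"
proof -
  let ?U = "UNIV - {0::'a}"
  have "bij_betw ((*) x) ?U ?U"
    by (rule bij_betwI[where g = "\<lambda>y. y / x"]) (use assms in auto)
  then have "(\<Prod>y\<in>?U. x * y) = \<Prod>?U" by (rule prod.reindex_bij_betw)
  then have "x ^ card ?U * \<Prod>?U = \<Prod>?U" by (simp add: prod.distrib)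
  moreover have "\<Prod>?U \<noteq> 0" by simp
  ultimately show ?thesis by (simp add: card_Diff_subset)
qed

text \<open>The functions \<open>y \<mapsto> f p y ^ (q - 1) - f x y ^ (q - 1)\<close> are the indicators of the points of \<open>X\<close>
  and lie in the span of the monomials of degree \<open>q - 1\<close>, counted here as words.\<close>

lemma card_le_of_bilinear_values:
  fixes c :: "'a::{field,finite} ^ 'n \<Rightarrow> 'n \<Rightarrow> 'a"
  defines "f \<equiv> \<lambda>x y. \<Sum>i\<in>UNIV. c x i * y $ i"
  assumes p: "\<And>y. y \<in> X \<Longrightarrow> f p y = 1"
    and diag: "\<And>x. x \<in> X \<Longrightarrow> f x x = 0"
    and off: "\<And>x y. x \<in> X \<Longrightarrow> y \<in> X \<Longrightarrow> x \<noteq> y \<Longrightarrow> f x y \<noteq> 0"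
  shows "card X \<le> CARD('n) ^ (CARD('a) - 1)"
proof -
  define k where "k = CARD('a) - 1"
  have k: "k > 0" using card_mono[of UNIV "{0,1::'a}"] by (simp add: k_def)
  let ?T = "{..<k} \<rightarrow>\<^sub>E (UNIV::'n set)"
  have f_pow: "f x y ^ k = (\<Sum>t\<in>?T. (\<Prod>j<k. c x (t j)) * (\<Prod>j<k. y $ t j))" for x y
    unfolding f_def by (rule sum_power_eq_sum_monomials)
  have "card X \<le> card ?T"
  proof (rule card_le_of_dual_systems)
    fix x y assume xy: "x \<in> X" "y \<in> X"
    have "(\<Sum>t\<in>?T. ((\<Prod>j<k. c p (t j)) - (\<Prod>j<k. c x (t j))) * (\<Prod>j<k. y $ t j))
        = f p y ^ k - f x y ^ k"
      by (simp add: f_pow left_diff_distrib sum_subtractf)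
    also have "\<dots> = (if x = y then 1 else 0)"
      using p[OF xy(2)] diag[OF xy(1)] off[OF xy] k finite_field_power_pred_card[of "f x y"]
      by (auto simp: k_def)
    finally show "(\<Sum>t\<in>?T. ((\<Prod>j<k. c p (t j)) - (\<Prod>j<k. c x (t j))) * (\<Prod>j<k. y $ t j))
        = (if x = y then 1 else 0)" .
  qed (auto intro!: finite_PiE)
  then show ?thesis by (simp add: card_PiE k_def)
qed

section \<open>The numerical estimate\<close>

text \<open>Used with \<open>r = 2 * d + 1\<close>. Raising \<open>r\<close> by one multiplies the
  right side by \<open>q\<close>, and the left side by at most 2.\<close>

lemma power_lt_power_exchange:
  fixes q r :: nat
  assumes q: "2 \<le> q" and r: "q ^ 2 + 5 \<le> r"
  shows "r ^ (2 * (q - 1)) < q ^ (r - 1)"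
  using r
proof (induction r rule: dec_induct)
  case base
  show ?case
  proof (cases "q = 2")
    \<comment> \<open>For \<open>q = 2\<close> this reads 81 < 256.\<close>
    case True then show ?thesis by simp
  next
    case False
    then have q3: "3 \<le> q" using q by simp
    have "q ^ 2 + 5 \<le> q ^ 2 + q ^ 2" using power_mono[OF q3, of 2] by simp
    also have "\<dots> \<le> q * q ^ 2" using q by (simp add: mult_right_mono flip: mult_2)
    finally have "q ^ 2 + 5 \<le> q ^ 3" by (simp add: power3_eq_cube power2_eq_square)
    then have "(q ^ 2 + 5) ^ (2 * (q - 1)) \<le> (q ^ 3) ^ (2 * (q - 1))" by (rule power_mono) simp
    also have "\<dots> = q ^ (6 * (q - 1))" by (simp flip: power_mult)
    also have "\<dots> < q ^ (q ^ 2 + 5 - 1)"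
    proof (rule power_strict_increasing)
      \<comment> \<open>The square gives \<open>6 * q - 6 \<le> q ^ 2 + 3\<close>, one below the
        exponent on the right.\<close>
      have "0 \<le> (int q - 3) ^ 2" by simp
      then have "6 * int q \<le> int q ^ 2 + 9" by (simp add: power2_eq_square algebra_simps)
      then have "int (6 * q) \<le> int (q ^ 2 + 9)" by simp
      then have "6 * q \<le> q ^ 2 + 9" by linarith
      then show "6 * (q - 1) < q ^ 2 + 5 - 1" using q by simp
    qed (use q in simp)
    finally show ?thesis .
  qed
next
  case (step r)
  define m where "m = 2 * (q - 1)"
  \<comment> \<open>The square gives \<open>2 * m = 4 * q - 4 \<le> q ^ 2\<close>, so
    \<open>m / (r + 1)\<close> is at most 1/2; Bernoulli then bounds
    \<open>((r + 1) / r) ^ m\<close> by 2.\<close>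
  have "0 \<le> (int q - 2) ^ 2" by simp
  then have "4 * int q \<le> int q ^ 2 + 4" by (simp add: power2_eq_square algebra_simps)
  then have "int (4 * q) \<le> int (q ^ 2 + 4)" by simp
  then have "4 * q \<le> q ^ 2 + 4" by linarith
  then have "2 * m \<le> r + 1" using step(1) by (simp add: m_def)
  then have "1 / 2 \<le> 1 + real m * (- (1 / (real r + 1)))"
    by (simp add: field_simps)
  also have "\<dots> \<le> (1 + - (1 / (real r + 1))) ^ m"
    by (rule Bernoulli_inequality) (simp add: field_simps)
  also have "1 + - (1 / (real r + 1)) = real r / (real r + 1)" by (simp add: field_simps)
  finally have "real (r + 1) ^ m \<le> 2 * real r ^ m"
    by (simp add: power_divide field_simps)
  then have "real ((r + 1) ^ m) \<le> real (2 * r ^ m)" by simp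
  then have "(r + 1) ^ m \<le> 2 * r ^ m" by linarith
  also have "\<dots> \<le> q * r ^ m" using q by simp
  also have "\<dots> < q * q ^ (r - 1)" using step.IH q by (simp add: m_def)
  also have "\<dots> = q ^ (Suc r - 1)" using step(1) by (cases r) auto
  finally show ?case by (simp add: m_def)
qed

section \<open>Quadratic equations over finite fields\<close>

lemma even_card_field_imp_two_eq_0:
  assumes "primepow CARD('a::{field,finite})" "even CARD('a)"
  shows "(2::'a) = 0"
proof -
  obtain p k where pk: "prime p" "CARD('a) = p ^ k"
    using assms(1) by (auto simp: primepow_def)
  then have "even p" using assms(2) by (metis even_power)
  then have "p = 2" using pk(1) by (metis primes_dvd_imp_eq two_is_prime_nat)
  \<comment> \<open>The characteristic divides the order \<open>2 ^ k\<close>, so a power of 2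
    vanishes in the field.\<close>
  moreover have "of_nat CARD('a) = (0::'a)"
    using CHAR_dvd_CARD of_nat_eq_0_iff_char_dvd by blast
  ultimately show ?thesis by (simp add: pk(2))
qed

lemma card_range_quadratic:
  fixes \<alpha> \<beta> :: "'a::{field,finite}"
  assumes "\<alpha> \<noteq> 0"
  shows "CARD('a) \<le> 2 * card (range (\<lambda>x. \<alpha> * x ^ 2 + \<beta> * x + \<gamma>))"
proof -
  let ?f = "\<lambda>x. \<alpha> * x ^ 2 + \<beta> * x + \<gamma>"
  have fib: "card (?f -` {y}) \<le> 2" if y: "y \<in> range ?f" for y
  proof -
    obtain a where a: "y = ?f a" using y by (rule rangeE)
    \<comment> \<open>By Vieta the two roots of \<open>?f x = y\<close> add up to
      \<open>- \<beta> / \<alpha>\<close>.\<close>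
    have "?f -` {y} \<subseteq> {a, - \<beta> / \<alpha> - a}"
    proof
      fix x assume "x \<in> ?f -` {y}"
      then have "(x - a) * (\<alpha> * (x + a) + \<beta>) = 0"
        by (simp add: a power2_eq_square algebra_simps)
      then have "x = a \<or> \<alpha> * (x + a) + \<beta> = 0" by auto
      then show "x \<in> {a, - \<beta> / \<alpha> - a}"
        using assms by (auto simp: field_simps eq_neg_iff_add_eq_0)
    qed
    then have "card (?f -` {y}) \<le> card {a, - \<beta> / \<alpha> - a}" by (intro card_mono) auto
    also have "\<dots> \<le> 2" by (simp add: card_insert_if)
    finally show ?thesis .
  qed
  have "CARD('a) = card (\<Union>y\<in>range ?f. ?f -` {y})" by (intro arg_cong[where f = card]) auto
  also have "\<dots> \<le> (\<Sum>y\<in>range ?f. card (?f -` {y}))" by (intro card_UN_le) auto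
  also have "\<dots> \<le> (\<Sum>y\<in>range ?f. 2)" by (intro sum_mono fib)
  finally show ?thesis by simp
qed

text \<open>Pigeonhole: for odd q, the values of one quadratic and the negated values of the other
  each fill more than half of the field, so they share an element.\<close>

lemma ex_sum_quadratics_eq_0:
  fixes \<alpha> \<beta> \<gamma> \<alpha>' \<beta>' :: "'a::{field,finite}"
  assumes "odd CARD('a)" "\<alpha> \<noteq> 0" "\<alpha>' \<noteq> 0"
  shows "\<exists>x y. \<alpha> * x ^ 2 + \<beta> * x + (\<alpha>' * y ^ 2 + \<beta>' * y) + \<gamma> = 0"
proof -
  let ?A = "range (\<lambda>x. \<alpha> * x ^ 2 + \<beta> * x + \<gamma>)"
  let ?B = "range (\<lambda>y. (- \<alpha>') * y ^ 2 + (- \<beta>') * y + 0)"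
  have "CARD('a) \<le> 2 * card ?A" "CARD('a) \<le> 2 * card ?B"
    using assms by (intro card_range_quadratic; simp)+
  then have "CARD('a) < card ?A + card ?B" using assms(1) by presburger
  then have "?A \<inter> ?B \<noteq> {}"
    using card_Un_disjoint[of ?A ?B] card_mono[of UNIV "?A \<union> ?B"] by force
  then obtain x y where "\<alpha> * x ^ 2 + \<beta> * x + \<gamma> = (- \<alpha>') * y ^ 2 + (- \<beta>') * y + 0" by blast
  then have "\<alpha> * x ^ 2 + \<beta> * x + (\<alpha>' * y ^ 2 + \<beta>' * y) + \<gamma> = 0"
    by (simp add: eq_neg_iff_add_eq_0 algebra_simps)
  then show ?thesis by blast
qed

text \<open>In characteristic 2 squaring is injective, hence surjective on a finite field.\<close>

lemma two_eq_0_imp_surj_square: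
  assumes "(2::'a::{field,finite}) = 0"
  shows "\<exists>x::'a. x ^ 2 = c"
proof -
  have "inj (\<lambda>x::'a. x ^ 2)"
  proof (rule injI)
    fix x y :: 'a assume "x ^ 2 = y ^ 2"
    then have "(x - y) ^ 2 = 2 * (y * y - x * y)"
      by (simp add: power2_eq_square algebra_simps)
    then show "x = y" by (simp add: assms)
  qed
  then have "surj (\<lambda>x::'a. x ^ 2)" by (simp add: finite_UNIV_inj_surj)
  then show ?thesis by (metis surjD)
qed

section \<open>Counting vectors in subspaces\<close>

lemma card_span_le:
  fixes S :: "('a::{field,finite} ^ 'n) set"
  shows "card (vec.span S) \<le> CARD('a) ^ vec.dim S"
proof -
  obtain B where B: "B \<subseteq> S" "S \<subseteq> vec.span B" "card B = vec.dim S"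
    by (rule vec.basis_exists)
  have "vec.span S = (\<lambda>u. \<Sum>v\<in>B. u v *s v) ` (B \<rightarrow>\<^sub>E UNIV)"
  proof -
    have "vec.span S = vec.span B"
      using vec.span_mono[OF B(1)] vec.span_minimal[OF B(2) vec.subspace_span] by (rule subset_antisym[rotated])
    also have "\<dots> = range (\<lambda>u. \<Sum>v\<in>B. u v *s v)" by (rule vec.span_finite) simp
    also have "\<dots> = (\<lambda>u. \<Sum>v\<in>B. u v *s v) ` (B \<rightarrow>\<^sub>E UNIV)"
    proof (intro subset_antisym subsetI)
      fix z assume "z \<in> range (\<lambda>u. \<Sum>v\<in>B. u v *s v)"
      then obtain u where "z = (\<Sum>v\<in>B. u v *s v)" by auto
      then have "z = (\<Sum>v\<in>B. restrict u B v *s v)" by simp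
      then show "z \<in> (\<lambda>u. \<Sum>v\<in>B. u v *s v) ` (B \<rightarrow>\<^sub>E UNIV)"
        by (intro rev_image_eqI[of "restrict u B"]) simp_all
    qed blast
    finally show ?thesis .
  qed
  then have "card (vec.span S) \<le> card (B \<rightarrow>\<^sub>E (UNIV::'a set))"
    by (simp add: card_image_le finite_PiE)
  then show ?thesis by (simp add: card_PiE B(3))
qed

text \<open>Unless \<open>\<phi>\<close> vanishes on \<open>U\<close>, the translates of its kernel
  by the multiples of one vector \<open>u0\<close> cover \<open>U\<close>.\<close>

lemma card_le_mult_card_kernel:
  fixes U :: "('a::{field,finite} ^ 'n) set" and \<phi> :: "'a ^ 'n \<Rightarrow> 'a"
  assumes "vec.subspace U"
    and add: "\<And>x y. \<phi> (x + y) = \<phi> x + \<phi> y" and scale: "\<And>c x. \<phi> (c *s x) = c * \<phi> x"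
  shows "card U \<le> CARD('a) * card {u \<in> U. \<phi> u = 0}"
proof (cases "\<forall>u\<in>U. \<phi> u = 0")
  case True
  then have "{u \<in> U. \<phi> u = 0} = U" by auto
  then show ?thesis by simp
next
  case False
  then obtain u0 where u0: "u0 \<in> U" "\<phi> u0 \<noteq> 0" by auto
  let ?g = "\<lambda>(c, u). c *s u0 + u"
  have "U \<subseteq> ?g ` (UNIV \<times> {u \<in> U. \<phi> u = 0})"
  proof
    fix u assume u: "u \<in> U"
    let ?c = "\<phi> u / \<phi> u0"
    have "u = ?c *s u0 + (u + (- ?c) *s u0)" by simp
    moreover have "\<phi> (u + (- ?c) *s u0) = 0" using u0(2) by (simp only: add scale) simp
    moreover have "u + (- ?c) *s u0 \<in> U"
      using assms(1) u u0 by (intro vec.subspace_add vec.subspace_scale)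
    ultimately show "u \<in> ?g ` (UNIV \<times> {u \<in> U. \<phi> u = 0})"
      by (intro rev_image_eqI[of "(?c, u + (- ?c) *s u0)"]) auto
  qed
  then have "card U \<le> card ((UNIV::'a set) \<times> {u \<in> U. \<phi> u = 0})"
    by (rule surj_card_le[rotated]) simp
  then show ?thesis by (simp add: card_cartesian_product)
qed

lemma subspace_dim_1_eq_span:
  fixes P :: "('a::field ^ 'n) set"
  assumes "vec.subspace P" "vec.dim P = 1" "x \<in> P" "x \<noteq> 0"
  shows "P = vec.span {x}"
proof -
  have "vec.span {x} \<subseteq> P" using assms by (simp add: vec.span_minimal)
  moreover have "vec.dim {x} = 1"
    using assms(4) by (simp add: vec.dim_insert)
  ultimately show ?thesis
    using assms(1,2) by (metis vec.dim_span vec.subspace_dim_equal vec.subspace_span order_refl)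
qed

lemma dim_1_ex_nonzero:
  fixes P :: "('a::field ^ 'n) set"
  assumes "vec.dim P = 1"
  obtains x where "x \<in> P" "x \<noteq> 0"
proof -
  have "\<not> P \<subseteq> {0}"
  proof
    assume "P \<subseteq> {0}"
    then have "vec.dim P \<le> vec.dim {0 :: 'a ^ 'n}" by (rule vec.dim_subset)
    then show False using assms by (simp add: vec.dim_insert)
  qed
  then show ?thesis using that by auto
qed

section \<open>Quadratic forms and totally singular subspaces\<close>

locale quadratic_space =
  fixes Q :: "'a::{field,finite} ^ 'n \<Rightarrow> 'a"
  assumes quadratic: "quadratic_form Q"
begin

abbreviation B where "B \<equiv> polar_form Q"

lemma Q_scale: "Q (c *s v) = c\<^sup>2 * Q v"
  using quadratic by (simp add: quadratic_form_def)

lemma Q_add: "Q (u + v) = Q u + Q v + B u v"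
  by (simp add: polar_form_def)

lemma B_commute: "B u v = B v u"
  by (simp add: polar_form_def add.commute)

lemma B_add_right: "B u (v + w) = B u v + B u w" and B_scale_right: "B u (c *s v) = c * B u v"
  using quadratic
  by (auto simp: quadratic_form_def Vector_Spaces.linear_iff_module_hom module_hom_iff)

lemma B_add_left: "B (v + w) u = B v u + B w u" and B_scale_left: "B (c *s v) u = c * B v u"
  by (simp_all add: B_commute[of _ u] B_add_right B_scale_right)

lemma B_zero_right [simp]: "B u 0 = 0"
  using B_scale_right[of u 0 0] by simp

lemma B_zero_left [simp]: "B 0 u = 0"
  by (simp add: B_commute[of 0])

lemma Q_zero [simp]: "Q 0 = 0"
  using Q_scale[of 0 0] by simp

lemma B_self: "B v v = 2 * Q v"
proof -
  have "v + v = 2 *s v" by (simp add: vec_eq_iff)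
  then have "Q (v + v) = Q (2 *s v)" by simp
  then show ?thesis by (simp add: polar_form_def Q_scale power2_eq_square)
qed

text \<open>Puts the polar form into the coordinate shape of
  \<open>card_le_of_bilinear_values\<close>.\<close>

lemma B_eq_sum: "B u v = (\<Sum>i\<in>UNIV. B u (axis i 1) * v $ i)"
proof -
  have "B u (\<Sum>i\<in>I. v $ i *s axis i 1) = (\<Sum>i\<in>I. B u (axis i 1) * v $ i)" if "finite I" for I
    using that by (induction I) (simp_all add: B_add_right B_scale_right mult.commute)
  from this[of UNIV] show ?thesis by (simp add: basis_expansion)
qed

lemma totally_singular_B:
  assumes "totally_singular Q W" "u \<in> W" "v \<in> W"
  shows "B u v = 0"
  using assms by (simp add: totally_singular_def polar_form_def vec.subspace_add)

lemma totally_singular_span_insert: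
  assumes W: "totally_singular Q W" and u: "Q u = 0" "\<And>w. w \<in> W \<Longrightarrow> B w u = 0"
  shows "totally_singular Q (vec.span (insert u W))"
  unfolding totally_singular_def
proof (intro conjI ballI)
  fix z assume "z \<in> vec.span (insert u W)"
  then obtain k where "z - k *s u \<in> W"
    using W by (metis vec.span_breakdown_eq vec.span_eq_iff totally_singular_def)
  moreover define w where "w = z - k *s u"
  ultimately have "w \<in> W" "z = w + k *s u" by simp_all
  then show "Q z = 0"
    using W u by (simp add: Q_add Q_scale B_scale_right totally_singular_def)
qed simp

section \<open>Extending totally singular subspaces to generators\<close>

text \<open>Each vector of \<open>S\<close> costs a factor of at most q. Equality can fail, since
  \<open>S\<close> may be dependent or meet the radical of \<open>B\<close>.\<close>

lemma card_perp_ge: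
  assumes "finite S"
  shows "CARD('a) ^ CARD('n) \<le> CARD('a) ^ card S * card {v. \<forall>s\<in>S. B s v = 0}"
  using assms
proof (induction S)
  case (insert x S)
  let ?U = "{v. \<forall>s\<in>S. B s v = 0}"
  have "vec.subspace ?U" by (auto simp: vec.subspace_def B_add_right B_scale_right)
  then have "card ?U \<le> CARD('a) * card {u \<in> ?U. B x u = 0}"
    by (rule card_le_mult_card_kernel) (simp_all add: B_add_right B_scale_right)
  also have "{u \<in> ?U. B x u = 0} = {v. \<forall>s\<in>insert x S. B s v = 0}" by auto
  finally have U: "card ?U \<le> CARD('a) * card {v. \<forall>s\<in>insert x S. B s v = 0}" .
  note insert.IH
  also have "CARD('a) ^ card S * card ?U \<le>
      CARD('a) ^ card S * (CARD('a) * card {v. \<forall>s\<in>insert x S. B s v = 0})"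
    using U by (rule mult_left_mono) simp
  also have "\<dots> = CARD('a) ^ card (insert x S) * card {v. \<forall>s\<in>insert x S. B s v = 0}"
    using insert.hyps by simp
  finally show ?case .
qed simp

text \<open>The common perp of \<open>S\<close> has too many vectors to fit into the span of
  \<open>T\<close>.\<close>

lemma ex_not_in_span:
  assumes "finite S" "card S + vec.dim T < CARD('n)"
  obtains u where "\<And>s. s \<in> S \<Longrightarrow> B s u = 0" "u \<notin> vec.span T"
proof -
  let ?q = "CARD('a)"
  have q: "1 < ?q" using card_mono[of UNIV "{0,1::'a}"] by simp
  have "?q ^ card S * card (vec.span T) \<le> ?q ^ card S * ?q ^ vec.dim T"
    by (simp add: card_span_le)
  also have "\<dots> < ?q ^ CARD('n)"
    using q assms(2) by (simp flip: power_add)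
  also have "\<dots> \<le> ?q ^ card S * card {v. \<forall>s\<in>S. B s v = 0}"
    by (rule card_perp_ge[OF assms(1)])
  finally have "card (vec.span T) < card {v. \<forall>s\<in>S. B s v = 0}" by simp
  then have "\<not> {v. \<forall>s\<in>S. B s v = 0} \<subseteq> vec.span T"
    using card_mono[of "vec.span T" "{v. \<forall>s\<in>S. B s v = 0}"] by auto
  then show ?thesis using that by auto
qed

text \<open>Choose \<open>u1, u2, u3\<close> in the perp of \<open>W\<close>, independent modulo \<open>W\<close>, with \<open>B u1 u2 = 0\<close>. Then
  \<open>Q (a *s u1 + b *s u2 + u3)\<close> is a quadratic in \<open>a\<close> plus a quadratic in \<open>b\<close>, and for odd \<open>q\<close> each of
  them takes more than \<open>q / 2\<close> values. For even \<open>q\<close>, \<open>Q (a *s u1 + b *s u2)\<close> vanishes when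
  \<open>a\<^sup>2 = Q u2\<close> and \<open>b\<^sup>2 = Q u1\<close>.\<close>

lemma ex_singular_perp:
  assumes pp: "primepow CARD('a)" and W: "totally_singular Q W"
    and dim: "2 * vec.dim W + 3 \<le> CARD('n)"
  obtains u where "Q u = 0" "\<And>w. w \<in> W \<Longrightarrow> B w u = 0" "u \<notin> W"
proof -
  have sub: "vec.subspace W" using W by (simp add: totally_singular_def)
  have span: "vec.span W = W" using sub by (simp add: vec.span_eq_iff)
  obtain S where S: "S \<subseteq> W" "W \<subseteq> vec.span S" "card S = vec.dim W"
    by (rule vec.basis_exists)
  have perp: "B w u = 0" if "\<And>s. s \<in> S \<Longrightarrow> B s u = 0" "w \<in> W" for u w
  proof -
    have "vec.subspace {v. B v u = 0}"
      by (auto simp: vec.subspace_def B_add_left B_scale_left)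
    then have "vec.span S \<subseteq> {v. B v u = 0}" using that(1) by (intro vec.span_minimal) auto
    then show ?thesis using S(2) that(2) by auto
  qed
  obtain u1 where u1: "\<And>s. s \<in> S \<Longrightarrow> B s u1 = 0" "u1 \<notin> vec.span W"
    using dim S(3) ex_not_in_span[of S W] by auto
  \<comment> \<open>Requiring \<open>B u1 u2 = 0\<close> adds one to both summands; for
    \<open>u3\<close> only the span grows, by two. Both totals are
    \<open>2 * vec.dim W + 2\<close>.\<close>
  have "card (insert u1 S) + vec.dim (insert u1 W) < CARD('n)"
    using dim S(3) u1(2) by (simp add: vec.dim_insert card_insert_if)
  then obtain u2 where u2: "\<And>s. s \<in> insert u1 S \<Longrightarrow> B s u2 = 0"
      "u2 \<notin> vec.span (insert u1 W)"
    using ex_not_in_span[of "insert u1 S" "insert u1 W"] by auto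
  have "card S + vec.dim (insert u2 (insert u1 W)) < CARD('n)"
    using dim S(3) u1(2) u2(2) by (simp add: vec.dim_insert)
  then obtain u3 where u3: "\<And>s. s \<in> S \<Longrightarrow> B s u3 = 0"
      "u3 \<notin> vec.span (insert u2 (insert u1 W))"
    using ex_not_in_span[of S "insert u2 (insert u1 W)"] by auto
  have notW: "u1 \<notin> W" "u2 \<notin> W"
    using u1(2) u2(2) vec.span_mono[of W "insert u1 W"] span by auto
  have perps: "B w u1 = 0" "B w u2 = 0" "B w u3 = 0" if "w \<in> W" for w
    using that by (blast intro: perp u1(1) u2(1) u3(1))+
  have B12: "B u1 u2 = 0" by (rule u2(1)) simp
  show ?thesis
  proof (cases "Q u1 = 0 \<or> Q u2 = 0")
    case True
    then show ?thesis using that notW perps by blast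
  next
    case False
    then have nz: "Q u1 \<noteq> 0" "Q u2 \<noteq> 0" by auto
    show ?thesis
    proof (cases "even CARD('a)")
      case True
      then have two: "(2::'a) = 0" by (rule even_card_field_imp_two_eq_0[OF pp])
      obtain a b where ab: "a ^ 2 = Q u2" "b ^ 2 = Q u1"
        using two_eq_0_imp_surj_square[OF two] by metis
      then have "b \<noteq> 0" using nz by auto
      show ?thesis
      proof (rule that)
        have "Q (a *s u1 + b *s u2) = 2 * (Q u1 * Q u2)"
          by (simp add: Q_add Q_scale ab B12 B_scale_left B_scale_right)
        then show "Q (a *s u1 + b *s u2) = 0" by (simp add: two)
        show "B w (a *s u1 + b *s u2) = 0" if "w \<in> W" for w
          using that by (simp add: perps B_add_right B_scale_right)
        show "a *s u1 + b *s u2 \<notin> W"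
        proof
          assume "a *s u1 + b *s u2 \<in> W"
          then have "a *s u1 + b *s u2 \<in> vec.span (insert u1 W)"
            by (intro vec.span_base) auto
          then have "(a *s u1 + b *s u2) - a *s u1 \<in> vec.span (insert u1 W)"
            by (rule vec.span_diff) (intro vec.span_scale vec.span_base insertI1)
          then have "b *s u2 \<in> vec.span (insert u1 W)" by simp
          then have "inverse b *s (b *s u2) \<in> vec.span (insert u1 W)"
            by (rule vec.span_scale)
          then show False using u2(2) \<open>b \<noteq> 0\<close> by simp
        qed
      qed
    next
      case False
      obtain a b where ab: "Q u1 * a ^ 2 + B u1 u3 * a + (Q u2 * b ^ 2 + B u2 u3 * b) + Q u3 = 0"
        using ex_sum_quadratics_eq_0[OF False nz] by blast
      show ?thesis
      proof (rule that)
        show "Q (a *s u1 + b *s u2 + u3) = 0"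
          using ab
          by (simp only: Q_add Q_scale B12 B_add_left B_scale_left B_scale_right) (simp add: ac_simps)
        show "B w (a *s u1 + b *s u2 + u3) = 0" if "w \<in> W" for w
          using that by (simp add: perps B_add_right B_scale_right)
        show "a *s u1 + b *s u2 + u3 \<notin> W"
        proof
          let ?T = "insert u2 (insert u1 W)"
          assume "a *s u1 + b *s u2 + u3 \<in> W"
          then have "a *s u1 + b *s u2 + u3 \<in> vec.span ?T"
            by (intro vec.span_base) auto
          then have "(a *s u1 + b *s u2 + u3) - (a *s u1 + b *s u2) \<in> vec.span ?T"
            by (rule vec.span_diff) (intro vec.span_add vec.span_scale vec.span_base; simp)
          then show False using u3(2) by simp
        qed
      qed
    qed
  qed
qed

text \<open>As long as \<open>vec.dim W < d\<close>, the dimension \<open>2 * d + 1\<close> leaves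
  room for one more vector from \<open>ex_singular_perp\<close>.\<close>

lemma totally_singular_extends_to_generator:
  assumes "primepow CARD('a)" "CARD('n) = 2 * d + 1"
    and "totally_singular Q W" "vec.dim W \<le> d"
  shows "\<exists>G\<in>generators d Q. W \<subseteq> G"
  using assms(3,4)
proof (induction "d - vec.dim W" arbitrary: W)
  case 0
  then show ?case by (auto simp: generators_def)
next
  case (Suc k)
  then have "2 * vec.dim W + 3 \<le> CARD('n)" using assms(2) by linarith
  from ex_singular_perp[OF assms(1) Suc.prems(1) this]
  obtain u where u: "Q u = 0" "\<And>w. w \<in> W \<Longrightarrow> B w u = 0" "u \<notin> W" by blast
  let ?W = "vec.span (insert u W)"
  have "u \<notin> vec.span W"
    using Suc.prems u(3) by (metis vec.span_eq_iff totally_singular_def)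
  then have "vec.dim ?W = Suc (vec.dim W)"
    by (simp add: vec.dim_insert)
  then have "\<exists>G\<in>generators d Q. ?W \<subseteq> G"
    using Suc.hyps(2) u Suc.prems
    by (intro Suc.hyps(1)) (auto intro: totally_singular_span_insert)
  then show ?case by (meson subset_trans vec.span_superset subset_insertI)
qed

section \<open>Sections of an ovoid\<close>

lemma ovoid_pointD:
  assumes "ovoid d Q \<O>" "P \<in> \<O>"
  shows "vec.subspace P" "vec.dim P = 1" "\<And>x. x \<in> P \<Longrightarrow> Q x = 0"
    and "\<And>x. x \<in> P \<Longrightarrow> x \<noteq> 0 \<Longrightarrow> P = vec.span {x}"
  using assms subspace_dim_1_eq_span[of P]
  by (auto simp: ovoid_def singular_points_def totally_singular_def)

lemma ovoid_unique:
  assumes "ovoid d Q \<O>" "W \<in> generators d Q" "P \<in> \<O>" "P \<subseteq> W" "R \<in> \<O>" "R \<subseteq> W"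
  shows "P = R"
  using assms unfolding ovoid_def by blast

text \<open>Every coset \<open>v + W\<close> with \<open>B p v = 1\<close> contains a vector on a point of the ovoid: the singular
  vector \<open>v - Q v *s p\<close> and the hyperplane of \<open>W\<close> orthogonal to \<open>v\<close> span a generator, whose
  ovoid point cannot lie in \<open>W\<close>.\<close>

lemma ovoid_meets_coset:
  assumes ov: "ovoid d Q \<O>" and W: "W \<in> generators d Q"
    and P: "P \<in> \<O>" "P \<subseteq> W" and p: "p \<in> P" "p \<noteq> 0" and v: "B p v = 1"
  shows "\<exists>x w. x \<in> \<Union>\<O> \<and> B p x = 1 \<and> w \<in> W \<and> v = x + w"
proof -
  have tsW: "totally_singular Q W" and dimW: "vec.dim W = d"
    using W by (auto simp: generators_def)
  then have subW: "vec.subspace W" by (simp add: totally_singular_def)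
  have pW: "p \<in> W" using P p by auto
  have Qp: "Q p = 0" using ovoid_pointD(3)[OF ov P(1)] p by simp
  have vp: "B v p = 1" using v by (simp add: B_commute)
  define H where "H = {w \<in> W. B v w = 0}"
  have subH: "vec.subspace H"
    using subW by (auto simp: H_def vec.subspace_def B_add_right B_scale_right)
  then have spanH: "vec.span H = H" by (simp add: vec.span_eq_iff)
  have tsH: "totally_singular Q H"
    using subH tsW by (auto simp: totally_singular_def H_def)
  have pH: "p \<notin> H" using vp by (simp add: H_def)
  \<comment> \<open>Subtracting \<open>B v w *s p\<close> moves \<open>w\<close> into
    \<open>H\<close>, so \<open>H\<close> has codimension 1 in \<open>W\<close>.\<close>
  have "W \<subseteq> vec.span (insert p H)"
  proof
    fix w assume "w \<in> W"
    then have "w - B v w *s p \<in> H"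
      using subW pW vp B_add_right[of v "w - B v w *s p" "B v w *s p"]
      by (simp add: H_def vec.subspace_diff vec.subspace_scale B_scale_right)
    then show "w \<in> vec.span (insert p H)"
      by (auto simp: vec.span_breakdown_eq spanH)
  qed
  moreover have "vec.span (insert p H) \<subseteq> W"
    using subW pW by (intro vec.span_minimal) (auto simp: H_def)
  ultimately have "vec.span (insert p H) = W" by blast
  then have dimH: "vec.dim H + 1 = d"
    using dimW pH vec.dim_span[of "insert p H"] by (simp add: vec.dim_insert spanH)
  \<comment> \<open>Since \<open>Q p = 0\<close> and \<open>B v p = 1\<close>, adding
    \<open>c *s p\<close> changes \<open>Q v\<close> by exactly \<open>c\<close>; products with
    vectors of \<open>W\<close> are unchanged.\<close>
  define v' where "v' = v + (- Q v) *s p"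
  have Qv': "Q v' = 0"
    by (simp add: v'_def Q_add Q_scale B_scale_right Qp vp del: vec.scale_minus_left)
  have pv': "B p v' = 1"
    by (simp add: v'_def B_add_right B_scale_right B_self Qp v del: vec.scale_minus_left)
  have Hv': "B w v' = 0" if "w \<in> H" for w
    using that totally_singular_B[OF tsW, of w p] pW
    by (simp add: v'_def H_def B_add_right B_scale_right B_commute[of w v]
        del: vec.scale_minus_left)
  have v'H: "v' \<notin> H"
    using pv' totally_singular_B[OF tsW pW, of v'] by (auto simp: H_def)
  have "vec.span (insert v' H) \<in> generators d Q"
    using totally_singular_span_insert[OF tsH Qv' Hv'] v'H dimH
    by (simp add: generators_def vec.dim_insert spanH)
  then obtain P' where P': "P' \<in> \<O>" "P' \<subseteq> vec.span (insert v' H)"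
    using ov by (auto simp: ovoid_def)
  note P'D = ovoid_pointD[OF ov P'(1)]
  obtain x where x: "x \<in> P'" "x \<noteq> 0" using P'D(2) by (rule dim_1_ex_nonzero)
  then have "x \<in> vec.span (insert v' H)" using P'(2) by blast
  then obtain k where "x - k *s v' \<in> H"
    unfolding vec.span_breakdown_eq spanH ..
  moreover define h where "h = x - k *s v'"
  ultimately have h: "h \<in> H" "x = k *s v' + h" by simp_all
  have hW: "h \<in> W" using h(1) by (simp add: H_def)
  \<comment> \<open>Otherwise \<open>P'\<close> lies in \<open>H\<close>, hence in \<open>W\<close>,
    and equals \<open>P\<close> by uniqueness, although \<open>p\<close> is not in
    \<open>H\<close>.\<close>
  have "k \<noteq> 0"
  proof
    assume "k = 0"
    then have "x \<in> H" using h by simp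
    then have "P' \<subseteq> H" using P'D(4)[OF x] subH by (simp add: vec.span_minimal)
    moreover have "H \<subseteq> W" by (auto simp: H_def)
    ultimately have "P' = P"
      using ovoid_unique[OF ov W P'(1) _ P] by blast
    then show False using \<open>P' \<subseteq> H\<close> p pH by auto
  qed
  \<comment> \<open>Rescaling makes the coefficient of \<open>v'\<close> equal to 1, so that
    \<open>y\<close> lies in the coset \<open>v + W\<close>.\<close>
  define y where "y = inverse k *s x"
  have y: "y = v' + inverse k *s h"
    using \<open>k \<noteq> 0\<close> by (simp add: y_def h(2) vec.scale_right_distrib)
  have "y \<in> P'" using P'D(1) x by (simp add: y_def vec.subspace_scale)
  moreover have "B p y = 1"
    using totally_singular_B[OF tsW pW hW] by (simp add: y B_add_right B_scale_right pv')
  moreover have "Q v *s p - inverse k *s h \<in> W"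
    using subW pW hW by (intro vec.subspace_diff vec.subspace_scale)
  moreover have "v = y + (Q v *s p - inverse k *s h)" by (simp add: y v'_def)
  ultimately show ?thesis using P'(1) by blast
qed

text \<open>The affine hyperplane \<open>?A\<close> has at least q^(2d) vectors, because its q
  translates along \<open>u\<close> cover the space. By \<open>ovoid_meets_coset\<close> it lies in
  the set of sums from \<open>?X\<close> and \<open>W\<close>, and \<open>W\<close> has at most q^d
  vectors.\<close>

lemma card_ovoid_section_ge:
  assumes ov: "ovoid d Q \<O>" and W: "W \<in> generators d Q" and n: "CARD('n) = 2 * d + 1"
    and P: "P \<in> \<O>" "P \<subseteq> W" and p: "p \<in> P" "p \<noteq> 0" and v0: "B p v0 \<noteq> 0"
  shows "CARD('a) ^ d \<le> card {x \<in> \<Union>\<O>. B p x = 1}"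
proof -
  let ?q = "CARD('a)" and ?X = "{x \<in> \<Union>\<O>. B p x = 1}" and ?A = "{v. B p v = 1}"
  define u where "u = inverse (B p v0) *s v0"
  have u: "B p u = 1" using v0 by (simp add: u_def B_scale_right)
  have "UNIV \<subseteq> (\<lambda>(c, a). a + c *s u) ` ((UNIV::'a set) \<times> ?A)"
  proof
    fix v
    have "v = (v + (1 - B p v) *s u) + (B p v - 1) *s u"
      by (simp add: vec.scale_left_diff_distrib)
    moreover have "B p (v + (1 - B p v) *s u) = 1"
      unfolding B_add_right B_scale_right by (simp add: u)
    ultimately show "v \<in> (\<lambda>(c, a). a + c *s u) ` ((UNIV::'a set) \<times> ?A)"
      by (intro image_eqI[of _ _ "(B p v - 1, v + (1 - B p v) *s u)"]) auto
  qed
  then have "CARD('a ^ 'n) \<le> card ((UNIV::'a set) \<times> ?A)"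
    by (rule surj_card_le[rotated]) simp
  then have "?q ^ (2 * d + 1) \<le> ?q * card ?A"
    by (simp add: card_cartesian_product n)
  then have "?q ^ d * ?q ^ d \<le> card ?A" by (simp add: mult_2 flip: power_add)
  also have "?A \<subseteq> (\<lambda>(x, w). x + w) ` (?X \<times> W)"
    using ovoid_meets_coset[OF ov W P p] by force
  then have "card ?A \<le> card (?X \<times> W)"
    by (rule surj_card_le[rotated]) simp
  also have "\<dots> = card ?X * card W" by (rule card_cartesian_product)
  also have "card W \<le> ?q ^ d"
    using card_span_le[of W] W
    by (metis (mono_tags, lifting) generators_def mem_Collect_eq totally_singular_def vec.span_eq_iff)
  finally show ?thesis by simp
qed

lemma card_ovoid_section_le:
  assumes ov: "ovoid d Q \<O>" and pp: "primepow CARD('a)" and n: "CARD('n) = 2 * d + 1"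
    and d: "2 \<le> d"
  shows "card {x \<in> \<Union>\<O>. B p x = 1} \<le> (2 * d + 1) ^ (CARD('a) - 1)"
proof -
  let ?X = "{x \<in> \<Union>\<O>. B p x = 1}"
  have QX: "Q x = 0" if "x \<in> ?X" for x
    using that ovoid_pointD(3)[OF ov] by auto
  have "card ?X \<le> CARD('n) ^ (CARD('a) - 1)"
  proof (rule card_le_of_bilinear_values[where c = "\<lambda>x i. B x (axis i 1)" and p = p],
      unfold B_eq_sum[symmetric])
    fix x y assume xy: "x \<in> ?X" "y \<in> ?X" "x \<noteq> y"
    show "B x y \<noteq> 0"
    proof
      assume Bxy: "B x y = 0"
      have "totally_singular Q {0}" by (simp add: totally_singular_def)
      then have "totally_singular Q (vec.span (insert x {0}))"
        by (rule totally_singular_span_insert) (use QX xy B_commute in auto)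
      then have "totally_singular Q (vec.span (insert y (vec.span (insert x {0}))))"
      proof (rule totally_singular_span_insert)
        fix w assume "w \<in> vec.span (insert x {0})"
        then obtain k where "w = k *s x"
          by (auto simp: vec.span_breakdown_eq)
        then show "B w y = 0" by (simp add: B_scale_left Bxy)
      qed (use QX xy in auto)
      \<comment> \<open>Rank at least 2 is what allows a generator to contain the line through both
        points.\<close>
      moreover have "vec.dim (vec.span (insert y (vec.span (insert x {0})))) \<le> d"
        using d by (simp add: vec.dim_insert)
      ultimately obtain G where G: "G \<in> generators d Q"
          "vec.span (insert y (vec.span (insert x {0}))) \<subseteq> G"
        using totally_singular_extends_to_generator[OF pp n] by blast
      have xyG: "x \<in> G" "y \<in> G"
        using G(2) by (meson insertI1 insertI2 subsetD vec.span_base)+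
      have subG: "vec.subspace G"
        using G(1) by (simp add: generators_def totally_singular_def)
      have nz: "x \<noteq> 0" "y \<noteq> 0" using xy by auto
      obtain P R where PR: "P \<in> \<O>" "x \<in> P" "R \<in> \<O>" "y \<in> R" using xy by auto
      have PG: "P = vec.span {x}" "R = vec.span {y}"
        using PR nz by (simp_all add: ovoid_pointD(4)[OF ov])
      then have "P \<subseteq> G" "R \<subseteq> G"
        using xyG subG by (simp_all add: vec.span_minimal)
      then have "P = R" using ovoid_unique[OF ov G(1)] PR by blast
      \<comment> \<open>As \<open>B p\<close> takes the value 1 at both vectors,
        \<open>k = 1\<close>, against \<open>x \<noteq> y\<close>.\<close>
      then obtain k where "y = k *s x" using PR PG by (auto simp: vec.span_singleton)
      then show False using xy by (auto simp: B_scale_right)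
    qed
  qed (use QX in \<open>auto simp: B_self\<close>)
  then show ?thesis by (simp add: n)
qed

end

theorem theorem6p5:
  fixes Q :: "'a::{field,finite} ^ 'n \<Rightarrow> 'a" and q d :: nat
  assumes "primepow q" and "CARD('a) = q"
    and "CARD('n) = 2 * d + 1"
    and "quadratic_form Q" and "nondegenerate Q"
    and "real d > (real q ^ 2 + 3) / 2"
  shows "\<not> (\<exists>\<O>. ovoid d Q \<O>)"
proof
  assume "\<exists>\<O>. ovoid d Q \<O>"
  then obtain \<O> where ov: "ovoid d Q \<O>" ..
  interpret quadratic_space Q by standard fact
  have pp: "primepow CARD('a)" using assms(1,2) by simp
  have "real (q ^ 2 + 3) < real (2 * d)" using assms(6) by (simp add: field_simps)
  then have qd: "q ^ 2 + 3 < 2 * d" by linarith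
  have q: "2 \<le> q" using primepow_gt_Suc_0[OF assms(1)] by simp
  have "totally_singular Q {0}" by (simp add: totally_singular_def)
  then obtain W where W: "W \<in> generators d Q"
    using totally_singular_extends_to_generator[OF pp assms(3), of "{0}"]
    by (auto simp: vec.dim_insert)
  then obtain P where P: "P \<in> \<O>" "P \<subseteq> W" using ov by (auto simp: ovoid_def)
  obtain p where p: "p \<in> P" "p \<noteq> 0"
    using ovoid_pointD(2)[OF ov P(1)] by (rule dim_1_ex_nonzero)
  \<comment> \<open>A nonzero singular vector is not in the radical of the polar form.\<close>
  then obtain v where v: "B p v \<noteq> 0"
    using assms(5) ovoid_pointD(3)[OF ov P(1)] by (auto simp: nondegenerate_def)
  have "q ^ d \<le> (2 * d + 1) ^ (q - 1)"
    using card_ovoid_section_ge[OF ov W assms(3) P p v]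
      card_ovoid_section_le[OF ov pp assms(3), of p] qd assms(2)
    by fastforce
  \<comment> \<open>Squaring turns \<open>d\<close> into \<open>r - 1\<close> for
    \<open>r = 2 * d + 1\<close>; by \<open>qd\<close>, \<open>r\<close> is at least
    \<open>q ^ 2 + 5\<close>.\<close>
  then have "(q ^ d) ^ 2 \<le> ((2 * d + 1) ^ (q - 1)) ^ 2" by (rule power_mono) simp
  then have "q ^ (2 * d) \<le> (2 * d + 1) ^ (2 * (q - 1))"
    by (simp only: mult.commute[of 2] power_mult)
  moreover have "(2 * d + 1) ^ (2 * (q - 1)) < q ^ (2 * d + 1 - 1)"
    using q qd by (intro power_lt_power_exchange) auto
  ultimately show False by simp
qed

end
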